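(* Let $C_4 = \{[X:Y:Z]\in\mathbb{P}^2 \mid X^4+Y^4+Z^4=0\}$, a smooth plane quartic over $\mathbb{Q}$, and let $\zeta_3=\exp(2\pi\sqrt{-1}/3)$. There are exactly $8$ points on $C_4$ which are defined over quadratic extensions of $\mathbb{Q}$. These are $$[1:\pm\zeta_3:\pm\zeta_3^2]\quad\text{and}\quad[1:\pm\zeta_3^2:\pm\zeta_3],$$ where in each expression the two signs are chosen independently.
   Context: Points are regarded as elements of $C_4(\overline{\mathbb{Q}})$; a point is defined over a quadratic extension of $\mathbb{Q}$ if it lies in $C_4(K)$ for some field $K\subset\overline{\mathbb{Q}}$ with $[K:\mathbb{Q}]=2$. *)

theory Defs
  imports Complex_Main "HOL-Algebra.Algebraic_Closure_Type"
begin

text \<open>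
  The algebraic closure of the rationals is realised as the subfield of algebraic numbers
  inside the complex numbers, so that \<open>exp (2 * pi * \<i> / 3)\<close> is one of its elements.
\<close>

definition Qbar :: "complex set" where
  "Qbar = {z. algebraic z}"

abbreviation CC :: "complex ring" where
  "CC \<equiv> ring_of_type_algebra"

text \<open>
  Here \<open>ring.dimension CC 2 \<rat> K\<close> is the degree condition \<open>[K : \<rat>] = 2\<close>; in the complex
  numbers \<open>\<rat>\<close> denotes the prime field.
\<close>

definition quadratic_extension :: "complex set \<Rightarrow> bool" where
  "quadratic_extension K \<longleftrightarrow> subfield K CC \<and> K \<subseteq> Qbar \<and> ring.dimension CC 2 \<rat> K"

type_synonym proj_pt = "(complex \<times> complex \<times> complex) set"

text \<open>
  The point \<open>[x : y : z]\<close> is the class of \<open>(x, y, z)\<close> modulo scaling by nonzero algebraic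
  numbers. It is meaningful only for algebraic coordinates that are not all zero.
\<close>

definition hpt :: "complex \<Rightarrow> complex \<Rightarrow> complex \<Rightarrow> proj_pt" where
  "hpt x y z = {(c * x, c * y, c * z) |c. c \<in> Qbar \<and> c \<noteq> 0}"

text \<open>
  For a subfield \<open>K\<close> of \<open>Qbar\<close>, the set of \<open>K\<close>-points is taken inside the plane over \<open>Qbar\<close>:
  a point is a \<open>K\<close>-point if it has some coordinate vector with entries in \<open>K\<close>.
\<close>

definition P2 :: "complex set \<Rightarrow> proj_pt set" where
  "P2 K = {hpt x y z |x y z. x \<in> K \<and> y \<in> K \<and> z \<in> K \<and> (x, y, z) \<noteq> (0, 0, 0)}"

definition C4 :: "complex set \<Rightarrow> proj_pt set" where
  "C4 K = {P \<in> P2 K. \<forall>(x, y, z) \<in> P. x ^ 4 + y ^ 4 + z ^ 4 = 0}"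

definition defined_over_quadratic :: "proj_pt \<Rightarrow> bool" where
  "defined_over_quadratic P \<longleftrightarrow> (\<exists>K. quadratic_extension K \<and> P \<in> C4 K)"

definition zeta3 :: complex where
  "zeta3 = exp (2 * of_real pi * \<i> / 3)"

end

theory Submission
  imports Defs
begin

text \<open>
  Let \<open>K\<close> be quadratic and \<open>t, u \<in> K\<close> with \<open>u\<^sup>2 + t\<^sup>4 + 1 = 0\<close> and \<open>t \<notin> \<rat>\<close>. Writing
  \<open>t\<^sup>2 = s t - n\<close> and \<open>u = \<alpha> + \<beta> t\<close> with rational coefficients, elimination puts \<open>p = s\<^sup>2 + \<beta>\<^sup>2 > 0\<close>
  on the elliptic curve \<open>r\<^sup>2 = p\<^sup>3 - 4 p\<close>. By descent (through \<open>x\<^sup>4 = 4 y\<^sup>4 + z\<^sup>2\<close> to Fermat's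
  \<open>x\<^sup>4 + y\<^sup>4 = z\<^sup>2\<close>) its rational points have \<open>r = 0\<close>, which forces \<open>n = 1\<close> and \<open>\<alpha> = 0\<close>, that is,
  \<open>t + 1 / t\<close> and \<open>u / t\<close> are rational.

  A quadratic point \<open>[1 : x : y]\<close> of the quartic gives three such pairs:
  \<open>(x, y\<^sup>2)\<close>, \<open>(y, x\<^sup>2)\<close> and \<open>(y / x, 1 / x\<^sup>2)\<close>. None of \<open>x\<close>, \<open>y\<close>, \<open>y / x\<close> can be rational, so
  \<open>x\<^sup>2 / y\<close>, \<open>y\<^sup>2 / x\<close>, \<open>1 / (x y)\<close> are, and hence so are \<open>x\<^sup>3\<close> and \<open>y\<^sup>3\<close>. As \<open>x\<close> and \<open>y\<close> have norm \<open>1\<close>,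
  they are sixth roots of unity.
\<close>

section \<open>Descent\<close>

lemma square_mod_4: "(n :: nat)\<^sup>2 mod 4 = n mod 2"
proof (cases "even n")
  case True
  then show ?thesis by (auto simp: power2_eq_square elim!: evenE)
next
  case False
  then obtain k where "n = 2 * k + 1" by (rule oddE)
  then have "n\<^sup>2 = 1 + 4 * (k\<^sup>2 + k)" by (simp add: power2_eq_square algebra_simps)
  then have "n\<^sup>2 mod 4 = 1" by (simp only: mod_mult_self2) simp
  with False show ?thesis by (simp add: odd_iff_mod_2_eq_one)
qed

lemma coprime_mult_square:
  fixes a b c :: nat
  assumes "coprime a b" "a * b = c\<^sup>2"
  obtains x y where "a = x\<^sup>2" "b = y\<^sup>2"
proof -
  have "is_nth_power 2 (a * b)" using assms(2) by (auto intro: is_nth_powerI)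
  then have "is_nth_power 2 a" "is_nth_power 2 b"
    using assms(1) by (metis is_nth_power_mult_coprime_nat_iff)+
  then show thesis by (auto elim!: is_nth_powerE intro: that)
qed

text \<open>Put \<open>p = (z + x) / 2\<close> and \<open>q = (z - x) / 2\<close>, so that
  \<open>p * q = (y / 2)^2\<close>. A common divisor of \<open>p\<close> and \<open>q\<close>
  divides both \<open>x\<close> and \<open>y\<close>, so they are coprime and each is a square.
  Stating \<open>a^2 = x + b^2\<close> avoids subtraction of naturals.\<close>

lemma pythagorean_triple_param:
  fixes x y z :: nat
  assumes cop: "coprime x y" and eq: "x\<^sup>2 + y\<^sup>2 = z\<^sup>2" and ev: "even y"
  obtains a b where "coprime a b" "a\<^sup>2 = x + b\<^sup>2" "y = 2 * a * b" "z = a\<^sup>2 + b\<^sup>2"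
proof -
  obtain r where r: "y = 2 * r" using ev by blast
  have ox: "odd x" using cop ev by (metis coprime_common_divisor odd_one)
  then have "odd (z\<^sup>2)" using eq ev by (metis even_add even_power)
  then have oz: "odd z" by simp
  have "x\<^sup>2 \<le> z\<^sup>2" unfolding eq[symmetric] by simp
  then have "x \<le> z" by (rule power2_le_imp_le) simp
  then obtain k where k: "z = x + k" using le_Suc_ex by blast
  with ox oz have "even k" by simp
  then obtain q where q: "k = 2 * q" by blast
  define p where "p = q + x"
  have z: "z = p + q" and p: "p = q + x" using k q p_def by auto
  have pq: "p * q = r\<^sup>2"
    using eq unfolding z r p by (simp add: power2_eq_square algebra_simps)
  have "coprime p q"
  proof (rule coprimeI)
    fix d assume d: "d dvd p" "d dvd q"
    then have dx: "d dvd x" unfolding p by (simp add: dvd_add_right_iff)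
    have "d\<^sup>2 dvd r\<^sup>2" using d mult_dvd_mono[OF d] pq by (simp add: power2_eq_square)
    then have "d dvd r" by simp
    then have "d dvd y" using r by simp
    with dx cop show "is_unit d" using coprime_common_divisor by blast
  qed
  with pq obtain a b where ab: "p = a\<^sup>2" "q = b\<^sup>2" using coprime_mult_square by blast
  have "r\<^sup>2 = (a * b)\<^sup>2" using pq ab by (simp add: power_mult_distrib)
  then have "r = a * b" by simp
  moreover have "coprime a b" using \<open>coprime p q\<close> ab by simp
  ultimately show thesis using that[of a b] ab p z r by simp
qed

text \<open>Two parametrisations in a row: \<open>(x^2, y^2, z)\<close> gives \<open>a\<close> and
  \<open>b\<close> with \<open>a^2 = x^2 + b^2\<close>, and \<open>(x, b, a)\<close> gives
  \<open>b = 2 c d\<close>, \<open>a = c^2 + d^2\<close>. Then \<open>(y / 2)^2 = c d a\<close> with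
  pairwise coprime factors, so \<open>c\<close>, \<open>d\<close>, \<open>a\<close> are squares and
  \<open>a = c^2 + d^2\<close> is a smaller solution.\<close>

lemma fermat_quartic_step:
  fixes x y z :: nat
  assumes cop: "coprime x y" and eq: "x ^ 4 + y ^ 4 = z\<^sup>2" and ev: "even y" and pos: "0 < x" "0 < y"
  obtains e f g where "0 < e" "0 < f" "g < z" "e ^ 4 + f ^ 4 = g\<^sup>2"
proof -
  have "(x\<^sup>2)\<^sup>2 + (y\<^sup>2)\<^sup>2 = z\<^sup>2" using eq by (simp flip: power_mult)
  moreover have "coprime (x\<^sup>2) (y\<^sup>2)" using cop by simp
  ultimately obtain a b where ab: "coprime a b" "a\<^sup>2 = x\<^sup>2 + b\<^sup>2" "y\<^sup>2 = 2 * a * b" "z = a\<^sup>2 + b\<^sup>2"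
    using pythagorean_triple_param[of "x\<^sup>2" "y\<^sup>2" z] ev by auto
  have b0: "0 < a" "0 < b" using ab(3) pos by (auto intro: gr0I)
  have ox: "odd x" using cop ev by (metis coprime_common_divisor odd_one)
  \<comment> \<open>The second parametrisation requires an even leg; two odd legs would give
    \<open>a^2\<close> the residue 2 modulo 4.\<close>
  have evb: "even b"
  proof (rule ccontr)
    assume "odd b"
    with ox have "x\<^sup>2 mod 4 = 1" "b\<^sup>2 mod 4 = 1" by (auto simp: square_mod_4 odd_iff_mod_2_eq_one)
    then have "a\<^sup>2 mod 4 = 2" unfolding ab(2) by (simp flip: mod_add_eq[of "x\<^sup>2"])
    then show False using square_mod_4[of a] mod_less_divisor[of 2 a] by simp
  qed
  have "coprime x b"
  proof (rule coprimeI)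
    fix d assume d: "d dvd x" "d dvd b"
    then have "d\<^sup>2 dvd a\<^sup>2" unfolding ab(2) by (simp add: dvd_add)
    then have "d dvd a" by simp
    with d ab(1) show "is_unit d" using coprime_common_divisor by blast
  qed
  then obtain c d where cd: "coprime c d" "b = 2 * c * d" "a = c\<^sup>2 + d\<^sup>2"
    using pythagorean_triple_param[of x b a] ab(2) evb by metis
  have cda: "coprime (c * d) a"
    using cd(1) unfolding cd(3)
    by (metis coprime_commute coprime_mult_left_iff coprime_power_right_iff
        coprime_iff_gcd_eq_1 gcd_add_mult power2_eq_square add.commute)
  obtain h where h: "y = 2 * h" using ev by blast
  have "(c * d) * a = h\<^sup>2" using ab(3) unfolding h cd(2) by (simp add: power2_eq_square)
  then obtain j g where jg: "c * d = j\<^sup>2" "a = g\<^sup>2" using cda coprime_mult_square by blast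
  then obtain e f where ef: "c = e\<^sup>2" "d = f\<^sup>2" using cd(1) coprime_mult_square by blast
  have "e ^ 4 + f ^ 4 = g\<^sup>2" using cd(3) ef jg by (simp flip: power_mult)
  moreover have "0 < e" "0 < f" using b0 cd ef by (auto intro: gr0I)
  moreover have "g < z"
  proof -
    have "g \<le> g\<^sup>2" by (simp add: power2_eq_square)
    also have "\<dots> = a" using jg by simp
    also have "a \<le> a\<^sup>2" by (simp add: power2_eq_square)
    also have "a\<^sup>2 < z" using ab(4) b0 by simp
    finally show ?thesis .
  qed
  ultimately show thesis using that by blast
qed

text \<open>Infinite descent on \<open>z\<close>. Dividing by the gcd gives a coprime solution with
  \<open>w \<le> z\<close>. Modulo 4 its two bases cannot both be odd, so up to a swap the descent
  step produces a solution below \<open>w\<close>.\<close>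

lemma fermat_quartic:
  fixes x y z :: nat
  assumes "x ^ 4 + y ^ 4 = z\<^sup>2" "0 < x" "0 < y"
  shows False
  using assms
proof (induction z arbitrary: x y rule: less_induct)
  case (less z)
  define g where "g = gcd x y"
  obtain u v where uv: "x = g * u" "y = g * v" "coprime u v"
    using gcd_coprime_exists[of x y] less.prems(2) unfolding g_def by (auto simp: mult.commute)
  have pos: "0 < g" "0 < u" "0 < v" using uv less.prems by (auto intro: gr0I)
  have zz: "z\<^sup>2 = (g\<^sup>2)\<^sup>2 * (u ^ 4 + v ^ 4)"
    using less.prems(1) uv by (simp add: power_mult_distrib algebra_simps flip: power_mult)
  then have "(g\<^sup>2)\<^sup>2 dvd z\<^sup>2" by simp
  then have "g\<^sup>2 dvd z" by (simp only: pow_divides_pow_iff zero_less_numeral)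
  then obtain w where w: "z = g\<^sup>2 * w" by blast
  have eq: "u ^ 4 + v ^ 4 = w\<^sup>2" using zz pos unfolding w by (simp add: power_mult_distrib)
  have "w \<le> z" unfolding w using pos by simp
  have step: False if st: "coprime s t" "s ^ 4 + t ^ 4 = w\<^sup>2" "even t" "0 < s" "0 < t" for s t
  proof -
    obtain e f h where "0 < e" "0 < f" "h < w" "e ^ 4 + f ^ 4 = h\<^sup>2"
      using fermat_quartic_step[OF st] by blast
    then show False using less.IH[of h e f] \<open>w \<le> z\<close> by simp
  qed
  consider "even v" | "even u" | "odd u" "odd v" by blast
  then show False
  proof cases
    case 1 then show False using step[of u v] uv(3) eq pos by simp
  next
    case 2 then show False using step[of v u] uv(3) eq pos by (simp add: coprime_commute add.commute)
  next
    case 3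
    then have "odd (u\<^sup>2)" "odd (v\<^sup>2)" by auto
    then have "(u\<^sup>2)\<^sup>2 mod 4 = 1" "(v\<^sup>2)\<^sup>2 mod 4 = 1" by (simp_all only: square_mod_4 odd_iff_mod_2_eq_one)
    then have "u ^ 4 mod 4 = 1" "v ^ 4 mod 4 = 1" by (simp_all flip: power_mult)
    then have "w\<^sup>2 mod 4 = 2" unfolding eq[symmetric] by (simp flip: mod_add_eq[of "u ^ 4"])
    then show False using square_mod_4[of w] mod_less_divisor[of 2 w] by simp
  qed
qed

text \<open>For odd \<open>x\<close>, \<open>(z, 2 y^2, x^2)\<close> is a primitive Pythagorean
  triple. Its parameters satisfy \<open>a b = y^2\<close>, hence are squares \<open>m^2\<close> and
  \<open>n^2\<close>, and \<open>m^4 + n^4 = x^2\<close> contradicts Fermat.\<close>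

lemma quartic_minus_4_quartic:
  fixes x y z :: nat
  assumes "x ^ 4 = 4 * y ^ 4 + z\<^sup>2" "0 < y" "coprime x y"
  shows False
proof (cases "even x")
  case True
  then obtain k where k: "x = 2 * k" by blast
  have "odd y" using True assms(3) by (metis coprime_common_divisor odd_one)
  have "even (z\<^sup>2)"
    using assms(1) True by (metis even_add even_mult_iff even_numeral even_power zero_less_numeral)
  then obtain h where h: "z = 2 * h" by auto
  \<comment> \<open>As \<open>y\<close> is odd, this would make -1 a square modulo 4.\<close>
  have "4 * k ^ 4 = (y\<^sup>2)\<^sup>2 + h\<^sup>2"
    using assms(1) unfolding k h by (simp add: power_mult_distrib flip: power_mult)
  moreover have "(y\<^sup>2)\<^sup>2 mod 4 = 1"
    using \<open>odd y\<close> by (simp only: square_mod_4 flip: odd_iff_mod_2_eq_one) simp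
  ultimately have "(1 + h\<^sup>2 mod 4) mod 4 = 0"
    by (metis mod_add_eq mod_mult_self1_is_0 mod_add_right_eq mod_add_left_eq)
  then show False using square_mod_4[of h] mod_less_divisor[of 2 h] by (auto simp: mod_Suc split: if_splits)
next
  case False
  have eq: "z\<^sup>2 + (2 * y\<^sup>2)\<^sup>2 = (x\<^sup>2)\<^sup>2" using assms(1) by (simp add: power_mult_distrib flip: power_mult)
  have "coprime (x\<^sup>2) (2 * y\<^sup>2)" using False assms(3) by simp
  have "coprime z (2 * y\<^sup>2)"
  proof (rule coprimeI)
    fix d assume d: "d dvd z" "d dvd 2 * y\<^sup>2"
    then have "d\<^sup>2 dvd z\<^sup>2" "d\<^sup>2 dvd (2 * y\<^sup>2)\<^sup>2"
      by (simp_all only: pow_divides_pow_iff zero_less_numeral)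
    then have "d\<^sup>2 dvd (x\<^sup>2)\<^sup>2" unfolding eq[symmetric] by (rule dvd_add)
    then have "d dvd x\<^sup>2" by (simp only: pow_divides_pow_iff zero_less_numeral)
    with d(2) \<open>coprime (x\<^sup>2) (2 * y\<^sup>2)\<close> show "is_unit d" using coprime_common_divisor by blast
  qed
  then obtain a b where ab: "coprime a b" "2 * y\<^sup>2 = 2 * a * b" "x\<^sup>2 = a\<^sup>2 + b\<^sup>2"
    using pythagorean_triple_param[OF _ eq] by (metis dvd_triv_left)
  then obtain m n where mn: "a = m\<^sup>2" "b = n\<^sup>2"
    using coprime_mult_square[of a b y] by auto
  have "m ^ 4 + n ^ 4 = x\<^sup>2" using ab(3) mn by (simp flip: power_mult)
  moreover have "0 < m" "0 < n" using ab(2) mn assms(2) by (auto intro: gr0I)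
  ultimately show False using fermat_quartic by blast
qed

section \<open>Rational points on the curve \<open>r^2 = p^3 - 4 p\<close>\<close>

text \<open>\<open>2 m n\<close> and \<open>d = m^2 - n^2\<close> are the legs of the primitive
  right triangle generated by \<open>m\<close> and \<open>n\<close>, so their product is twice its
  area. Being coprime, both legs would be squares. Even \<open>m\<close> fails modulo 4; even
  \<open>n\<close> gives \<open>m = x^2\<close>, \<open>n = 2 h^2\<close> and a solution of
  \<open>x^4 = 4 h^4 + z^2\<close>.\<close>

lemma double_area_not_square_parity:
  fixes m n c d :: nat
  assumes cop: "coprime m n" and par: "odd (m + n)" and pos: "0 < n" "0 < d"
    and diff: "m\<^sup>2 = n\<^sup>2 + d" and eq: "2 * m * n * d = c\<^sup>2"
  shows False
proof -
  have od: "odd d" using diff par by (metis even_add even_power zero_less_numeral)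
  have m0: "0 < m" using diff pos by (auto intro: gr0I)
  have md: "coprime m d"
  proof (rule coprimeI)
    fix e assume e: "e dvd m" "e dvd d"
    then have "e dvd n\<^sup>2 + d" unfolding diff[symmetric] by (simp add: power2_eq_square)
    then have "e dvd n\<^sup>2" using e dvd_add_left_iff by blast
    moreover have "coprime m (n\<^sup>2)" using cop by simp
    ultimately show "is_unit e" using e(1) coprime_common_divisor by blast
  qed
  have nd: "coprime n d"
  proof (rule coprimeI)
    fix e assume e: "e dvd n" "e dvd d"
    then have "e dvd m\<^sup>2" unfolding diff by (simp add: power2_eq_square)
    moreover have "coprime (m\<^sup>2) n" using cop by simp
    ultimately show "is_unit e" using e(1) coprime_common_divisor by blast
  qed
  have "coprime (2 * m * n) d" using md nd od by simp
  then obtain r z where rz: "2 * m * n = r\<^sup>2" "d = z\<^sup>2" using eq coprime_mult_square by metis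
  show False
  proof (cases "even m")
    case True
    then have on: "odd n" using par by simp
    then have "coprime (2 * m) n" using cop by simp
    then obtain x y where xy: "2 * m = x\<^sup>2" "n = y\<^sup>2" using rz(1) coprime_mult_square by metis
    then obtain h where "x = 2 * h" by (metis dvd_triv_left even_power evenE)
    then have "m = 2 * h\<^sup>2" using xy by (simp add: power_mult_distrib)
    then have "m\<^sup>2 mod 4 = 0" by (simp add: power_mult_distrib)
    moreover have "n\<^sup>2 mod 4 = 1" "z\<^sup>2 mod 4 = 1 \<or> z\<^sup>2 mod 4 = 0"
      using on by (auto simp: square_mod_4 odd_iff_mod_2_eq_one)
    then have "(n\<^sup>2 + z\<^sup>2) mod 4 \<noteq> 0" by (auto simp flip: mod_add_eq[of "n\<^sup>2"])
    ultimately show False using diff rz(2) by simp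
  next
    case False
    then have "coprime m (2 * n)" using cop by simp
    moreover have "m * (2 * n) = r\<^sup>2" using rz(1) by (simp add: ac_simps)
    ultimately obtain x y where xy: "m = x\<^sup>2" "2 * n = y\<^sup>2" using coprime_mult_square by metis
    then obtain h where h: "y = 2 * h" by (metis dvd_triv_left even_power evenE)
    have n: "n = 2 * h\<^sup>2" using xy(2) unfolding h by (simp add: power_mult_distrib)
    have "x ^ 4 = 4 * h ^ 4 + z\<^sup>2"
      using diff unfolding xy(1) n rz(2) by (simp add: power_mult_distrib flip: power_mult)
    moreover have "coprime x h" using cop unfolding xy(1) n by simp
    moreover have "0 < h" using n pos by (auto intro: gr0I)
    ultimately show False using quartic_minus_4_quartic by blast
  qed
qed

text \<open>When \<open>m\<close> and \<open>n\<close> are both odd, pass to the half sum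
  \<open>e\<close> and half difference \<open>f\<close>, which have opposite parity. Since
  \<open>d = 4 e f\<close> and \<open>e^2 - f^2 = m n\<close>, the two legs exchange roles, up to a
  factor of 2 each.\<close>

lemma double_area_not_square:
  fixes m n c d :: nat
  assumes cop: "coprime m n" and pos: "0 < n" "0 < d"
    and diff: "m\<^sup>2 = n\<^sup>2 + d" and eq: "2 * m * n * d = c\<^sup>2"
  shows False
proof (cases "odd (m + n)")
  case True
  then show False using double_area_not_square_parity assms by blast
next
  case False
  then have par: "even (m + n)" by simp
  have "n\<^sup>2 \<le> m\<^sup>2" using diff by simp
  then have "n \<le> m" by (rule power2_le_imp_le) simp
  then obtain k where k: "m = n + k" using le_Suc_ex by blast
  with par obtain f where f: "k = 2 * f" by auto
  define e where "e = n + f"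
  have mn: "m = e + f" "e = n + f" using k f e_def by auto
  have "d = 4 * e * f" using diff unfolding mn by (simp add: power2_eq_square algebra_simps)
  then have f0: "0 < f" using pos by (auto intro: gr0I)
  have ef: "coprime e f"
  proof (rule coprimeI)
    fix x assume x: "x dvd e" "x dvd f"
    then have "x dvd m" "x dvd n" unfolding mn using mn(2) dvd_add_left_iff by auto
    then show "is_unit x" using cop coprime_common_divisor by blast
  qed
  have "odd n" using par cop by (metis even_add coprime_common_divisor odd_one)
  then have "odd (e + f)" unfolding mn by simp
  have "even (c\<^sup>2)" unfolding eq[symmetric] by simp
  then obtain h where h: "c = 2 * h" by auto
  have "2 * e * f * (m * n) = h\<^sup>2" using eq unfolding h \<open>d = 4 * e * f\<close> by (simp add: power_mult_distrib ac_simps)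
  moreover have "e\<^sup>2 = f\<^sup>2 + m * n" unfolding mn by (simp add: power2_eq_square algebra_simps)
  ultimately show False
    using double_area_not_square_parity[OF ef \<open>odd (e + f)\<close> f0, of "m * n" h] pos(1) mn(1) f0 by simp
qed

text \<open>Here \<open>a / b\<close> is the abscissa of a point in lowest terms, and
  \<open>d\<close> is \<open>a^2 - 4 b^2\<close>. For odd \<open>a\<close> the factors
  \<open>a\<close>, \<open>b\<close>, \<open>d\<close> are pairwise coprime, hence squares. For even
  \<open>a\<close>, halving \<open>a\<close> and dividing \<open>d\<close> by 4 gives the triangle
  problem.\<close>

lemma congruent_2_curve_nat:
  fixes a b c d :: nat
  assumes cop: "coprime a b" and pos: "0 < b" "0 < d"
    and diff: "a\<^sup>2 = 4 * b\<^sup>2 + d" and eq: "a * b * d = c\<^sup>2"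
  shows False
proof (cases "even a")
  case True
  then obtain m where m: "a = 2 * m" by blast
  have "4 dvd d"
    using diff[unfolded m four_x_squared[symmetric]]
    by (simp add: power_mult_distrib) (metis dvd_add_right_iff dvd_triv_left)
  then obtain e where e: "d = 4 * e" by blast
  have "even (c\<^sup>2)" unfolding eq[symmetric] m by simp
  then obtain h where h: "c = 2 * h" by auto
  have "2 * m * b * e = h\<^sup>2" using eq unfolding m e h by (simp add: power_mult_distrib ac_simps)
  moreover have "m\<^sup>2 = b\<^sup>2 + e" using diff unfolding m e by (simp add: power_mult_distrib)
  moreover have "coprime m b" using cop m by simp
  ultimately show False using double_area_not_square pos e by simp
next
  case False
  have ad: "coprime a d"
  proof (rule coprimeI)
    fix e assume e: "e dvd a" "e dvd d"
    then have "e dvd 4 * b\<^sup>2 + d" unfolding diff[symmetric] by (simp add: power2_eq_square)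
    then have "e dvd 4 * b\<^sup>2" using e dvd_add_left_iff by blast
    moreover have "coprime a (2\<^sup>2)" using False by (simp only: coprime_power_right_iff) simp
    then have "coprime a (4 * b\<^sup>2)" using cop by simp
    ultimately show "is_unit e" using e(1) coprime_common_divisor by blast
  qed
  have bd: "coprime b d"
  proof (rule coprimeI)
    fix e assume e: "e dvd b" "e dvd d"
    then have "e dvd a\<^sup>2" unfolding diff by (simp add: power2_eq_square)
    moreover have "coprime (a\<^sup>2) b" using cop by simp
    ultimately show "is_unit e" using e(1) coprime_common_divisor by blast
  qed
  have "coprime (a * b) d" using ad bd by simp
  then obtain r z where rz: "a * b = r\<^sup>2" "d = z\<^sup>2" using eq coprime_mult_square by metis
  then obtain x y where xy: "a = x\<^sup>2" "b = y\<^sup>2" using cop coprime_mult_square by metis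
  have "x ^ 4 = 4 * y ^ 4 + z\<^sup>2" using diff xy rz(2) by (simp flip: power_mult)
  moreover have "coprime x y" "0 < y" using cop pos xy by (auto intro: gr0I)
  ultimately show False using quartic_minus_4_quartic by blast
qed

lemma rat_nonneg_quotient:
  fixes q :: rat
  assumes "0 \<le> q"
  obtains a b :: nat where "q = of_nat a / of_nat b" "0 < b" "coprime a b"
proof -
  obtain i j where ij: "quotient_of q = (i, j)" by fastforce
  have j: "0 < j" using quotient_of_denom_pos[OF ij] .
  have q: "q = of_int i / of_int j" using quotient_of_div[OF ij] .
  then have i: "0 \<le> i" using assms j by (simp add: zero_le_divide_iff)
  have "coprime i j" using quotient_of_coprime[OF ij] .
  then have "coprime (nat i) (nat j)" using i j by (metis coprime_int_iff nat_0_le less_imp_le)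
  moreover have "q = of_nat (nat i) / of_nat (nat j)" using q i j by simp
  ultimately show thesis using that[of "nat i" "nat j"] j by simp
qed

text \<open>This is the congruent number curve of 2. A point with \<open>0 < p\<close> and nonzero
  ordinate would yield a coprime natural solution of \<open>a b (a^2 - 4 b^2) = c^2\<close> with all
  factors positive.\<close>

lemma congruent_2_curve_rat:
  fixes p r :: rat
  assumes pos: "0 < p" and eq: "p ^ 3 = 4 * p + r\<^sup>2"
  shows "r = 0"
proof (rule ccontr)
  assume r0: "r \<noteq> 0"
  obtain a b :: nat where ab: "p = of_nat a / of_nat b" "0 < b" "coprime a b"
    using rat_nonneg_quotient[of p] pos by auto
  obtain k l :: nat where kl: "\<bar>r\<bar> = of_nat k / of_nat l" "0 < l"
    using rat_nonneg_quotient[of "\<bar>r\<bar>"] abs_ge_zero by blast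
  have k0: "0 < k" using r0 kl by (auto intro: gr0I)
  have a0: "0 < a" using pos ab by (auto intro: gr0I)
  have A: "of_nat a = p * of_nat b" and K: "of_nat k = \<bar>r\<bar> * of_nat l"
    using ab kl by simp_all
  \<comment> \<open>Multiplying the curve equation by \<open>b^4 l^2\<close> clears every
    denominator; afterwards \<open>l\<close> divides \<open>k b^2\<close>, and \<open>l^2\<close>
    cancels.\<close>
  have "(of_nat (a ^ 3 * b * l\<^sup>2) :: rat) = p ^ 3 * (of_nat b ^ 4 * of_nat l ^ 2)"
    by (simp add: A power_mult_distrib eval_nat_numeral)
  also have "\<dots> = (4 * p + \<bar>r\<bar>\<^sup>2) * (of_nat b ^ 4 * of_nat l ^ 2)"
    unfolding eq by simp
  also have "\<dots> = of_nat (4 * a * b ^ 3 * l\<^sup>2 + (k * b\<^sup>2)\<^sup>2)"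
    by (simp add: A K power_mult_distrib algebra_simps eval_nat_numeral)
  finally have "(of_nat (a ^ 3 * b * l\<^sup>2) :: rat) = of_nat (4 * a * b ^ 3 * l\<^sup>2 + (k * b\<^sup>2)\<^sup>2)" .
  then have nateq: "a ^ 3 * b * l\<^sup>2 = 4 * a * b ^ 3 * l\<^sup>2 + (k * b\<^sup>2)\<^sup>2" by (simp only: of_nat_eq_iff)
  have "l\<^sup>2 dvd (k * b\<^sup>2)\<^sup>2"
    using nateq by (metis dvd_add_right_iff dvd_triv_right)
  then have "l dvd k * b\<^sup>2" by (simp only: pow_divides_pow_iff zero_less_numeral)
  then obtain c where c: "k * b\<^sup>2 = l * c" by blast
  have "a ^ 3 * b * l\<^sup>2 = (4 * a * b ^ 3 + c\<^sup>2) * l\<^sup>2"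
    using nateq unfolding c by (simp add: algebra_simps)
  then have abc: "a ^ 3 * b = 4 * a * b ^ 3 + c\<^sup>2" using kl(2) by simp
  have c0: "0 < c" using c k0 ab(2) by (auto intro: gr0I)
  have "(a * b) * (4 * b\<^sup>2) < (a * b) * a\<^sup>2"
    using abc c0 by (simp add: eval_nat_numeral algebra_simps)
  then have "4 * b\<^sup>2 < a\<^sup>2" by simp
  then obtain d where d: "a\<^sup>2 = 4 * b\<^sup>2 + d" "0 < d" using less_imp_add_positive by metis
  have "a ^ 3 * b = (a * b) * a\<^sup>2" by (simp add: eval_nat_numeral algebra_simps)
  then have "a * b * d = c\<^sup>2" using abc unfolding d(1) by (simp add: eval_nat_numeral algebra_simps)
  then show False using congruent_2_curve_nat ab d by blast
qed

lemma two_not_rat_square: "(s :: rat)\<^sup>2 \<noteq> 2"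
proof
  assume s: "s\<^sup>2 = 2"
  obtain a b :: nat where ab: "\<bar>s\<bar> = of_nat a / of_nat b" "0 < b" "coprime a b"
    using rat_nonneg_quotient[of "\<bar>s\<bar>"] by auto
  have "(\<bar>s\<bar>)\<^sup>2 = 2" using s by simp
  then have "(of_nat (a\<^sup>2) :: rat) = of_nat (2 * b\<^sup>2)"
    unfolding ab(1) using ab(2) by (simp add: field_simps power2_eq_square)
  then have "a\<^sup>2 = 2 * b\<^sup>2" by (simp only: of_nat_eq_iff)
  \<comment> \<open>Squaring once more exhibits a solution of the quartic equation with
    \<open>z = 0\<close>.\<close>
  then have "(a\<^sup>2)\<^sup>2 = (2 * b\<^sup>2)\<^sup>2" by simp
  then have "a ^ 4 = 4 * b ^ 4 + 0\<^sup>2" by (simp add: power_mult_distrib flip: power_mult)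
  then show False using quartic_minus_4_quartic ab by blast
qed

text \<open>The two hypotheses say that the coefficients of \<open>t\<close> and of 1 vanish when
  \<open>u^2 + t^4 + 1\<close> is reduced by \<open>t^2 = s t - n\<close> and
  \<open>u = \<alpha> + \<beta> t\<close>.\<close>

lemma quadratic_point_coefficients:
  fixes s n \<alpha> \<beta> :: rat
  assumes lin: "2 * \<alpha> * \<beta> + \<beta>\<^sup>2 * s + s ^ 3 - 2 * s * n = 0"
    and const: "\<alpha>\<^sup>2 - \<beta>\<^sup>2 * n + 1 + n\<^sup>2 - s\<^sup>2 * n = 0"
  shows "n = 1 \<and> \<alpha> = 0"
proof -
  define p where "p = s\<^sup>2 + \<beta>\<^sup>2"
  \<comment> \<open>In terms of \<open>p\<close> and \<open>q\<close> the equations become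
    \<open>s q = - 2 \<alpha> \<beta>\<close> and \<open>p^2 = q^2 + 4 \<alpha>^2 + 4\<close>, which
    no longer involve \<open>n\<close>.\<close>
  define q where "q = p - 2 * n"
  have n: "n = (p - q) / 2" using q_def by simp
  have sq: "s * q = - (2 * \<alpha> * \<beta>)" using lin unfolding q_def p_def by (simp add: algebra_simps eval_nat_numeral)
  have np: "n * (p - n) = 1 + \<alpha>\<^sup>2"
    using const unfolding p_def by (simp add: algebra_simps power2_eq_square)
  have "p\<^sup>2 = q\<^sup>2 + 4 * (n * (p - n))"
    unfolding q_def by (simp add: algebra_simps power2_eq_square)
  then have pq: "p\<^sup>2 = q\<^sup>2 + 4 * \<alpha>\<^sup>2 + 4" unfolding np by simp
  have "p \<noteq> 0"
  proof
    assume "p = 0"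
    then have "q\<^sup>2 + 4 * \<alpha>\<^sup>2 + 4 = 0" using pq by simp
    moreover have "0 \<le> q\<^sup>2" "0 \<le> \<alpha>\<^sup>2" by simp_all
    ultimately show False by linarith
  qed
  then have p0: "0 < p" unfolding p_def by (simp add: sum_power2_gt_zero_iff)
  have "q = 0 \<and> \<alpha> = 0"
  \<comment> \<open>The point on the curve is \<open>(p, p q / \<beta>)\<close>. For
    \<open>\<beta> = 0\<close> its ordinate is replaced by \<open>2 \<alpha> s\<close>, as suggested
    by \<open>q / \<beta> = - 2 \<alpha> / s\<close> and \<open>p = s^2\<close>.\<close>
  proof (cases "\<beta> = 0")
    case True
    then have ps: "p = s\<^sup>2" using p_def by simp
    then have "s \<noteq> 0" using p0 by auto
    then have q: "q = 0" using sq True by simp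
    have "p ^ 3 = p * p\<^sup>2" by (simp add: eval_nat_numeral)
    also have "\<dots> = p * (4 * \<alpha>\<^sup>2 + 4)" using pq q by simp
    also have "\<dots> = 4 * p + (2 * \<alpha> * s)\<^sup>2" unfolding ps by (simp add: power_mult_distrib algebra_simps)
    finally have "p ^ 3 = 4 * p + (2 * \<alpha> * s)\<^sup>2" .
    then have "2 * \<alpha> * s = 0" using congruent_2_curve_rat p0 by blast
    then show ?thesis using q \<open>s \<noteq> 0\<close> by simp
  next
    case False
    have "q\<^sup>2 * p = (s * q)\<^sup>2 + q\<^sup>2 * \<beta>\<^sup>2" unfolding p_def by (simp add: power_mult_distrib algebra_simps)
    also have "\<dots> = \<beta>\<^sup>2 * (p\<^sup>2 - 4)" unfolding sq pq by (simp add: power_mult_distrib algebra_simps)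
    finally have qp: "q\<^sup>2 * p = \<beta>\<^sup>2 * (p\<^sup>2 - 4)" .
    have "(p * q / \<beta>)\<^sup>2 = p * (q\<^sup>2 * p) / \<beta>\<^sup>2" by (simp add: power_divide power_mult_distrib power2_eq_square)
    also have "\<dots> = p * (p\<^sup>2 - 4)" unfolding qp using False by simp
    finally have "p ^ 3 = 4 * p + (p * q / \<beta>)\<^sup>2" by (simp add: algebra_simps eval_nat_numeral)
    then have "p * q / \<beta> = 0" using congruent_2_curve_rat p0 by blast
    then have "q = 0" using p0 False by simp
    then show ?thesis using sq False by simp
  qed
  moreover from this have "p\<^sup>2 = 2\<^sup>2" using pq by simp
  then have "p = 2" by (rule power2_eq_imp_eq) (use p0 in simp_all)
  ultimately show ?thesis using n by simp
qed

section \<open>Subfields of the complex numbers\<close>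

lemma CC_simps:
  "carrier CC = UNIV" "x \<otimes>\<^bsub>CC\<^esub> y = x * y" "x \<oplus>\<^bsub>CC\<^esub> y = x + y"
  "\<one>\<^bsub>CC\<^esub> = 1" "\<zero>\<^bsub>CC\<^esub> = 0"
  by (simp_all add: ring_of_type_algebra_def)

lemma field_CC: "field CC"
  by (rule field_from_type_algebra)

lemma ring_CC: "ring CC"
  by (rule ring_from_type_algebra)

lemma a_inv_CC: "\<ominus>\<^bsub>CC\<^esub> x = - x"
proof -
  interpret CC: field CC by (rule field_CC)
  show ?thesis by (rule CC.minus_equality) (simp_all add: CC_simps)
qed

lemma m_inv_CC: "x \<noteq> 0 \<Longrightarrow> inv\<^bsub>CC\<^esub> x = inverse x"
proof -
  interpret CC: field CC by (rule field_CC)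
  show "x \<noteq> 0 \<Longrightarrow> inv\<^bsub>CC\<^esub> x = inverse x" by (rule CC.comm_inv_char) (simp_all add: CC_simps)
qed

lemma nat_pow_CC: "x [^]\<^bsub>CC\<^esub> (n :: nat) = x ^ n"
proof -
  interpret CC: field CC by (rule field_CC)
  show ?thesis by (induction n) (simp_all add: CC_simps mult.commute)
qed

lemma subfield_CC_iff:
  "subfield K CC \<longleftrightarrow> 1 \<in> K \<and> (\<forall>x\<in>K. - x \<in> K) \<and> (\<forall>x\<in>K. \<forall>y\<in>K. x + y \<in> K)
    \<and> (\<forall>x\<in>K. \<forall>y\<in>K. x * y \<in> K) \<and> (\<forall>x\<in>K. x \<noteq> 0 \<longrightarrow> inverse x \<in> K)" (is "?l \<longleftrightarrow> ?r")
proof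
  interpret CC: field CC by (rule field_CC)
  assume K: ?l
  note sub = subringE[OF subfieldE(1)[OF K], unfolded CC_simps a_inv_CC]
  have inv: "inverse x \<in> K" if "x \<in> K" "x \<noteq> 0" for x
    using CC.subfield_m_inv(1)[OF K, of x] that by (simp add: CC_simps m_inv_CC)
  show ?r by (intro conjI ballI impI sub(3,5-7) inv; assumption)
next
  interpret CC: field CC by (rule field_CC)
  assume r: ?r
  show ?l
  proof (rule CC.subfieldI'[OF CC.subringI], unfold CC_simps a_inv_CC)
    fix k assume "k \<in> K - {0}"
    then have "k \<in> K" "k \<noteq> 0" by blast+
    then show "inv\<^bsub>CC\<^esub> k \<in> K" unfolding m_inv_CC[OF \<open>k \<noteq> 0\<close>] using r by blast
  qed (use r in blast)+
qed

lemma subfield_Rats_CC: "subfield \<rat> CC"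
  unfolding subfield_CC_iff by auto

text \<open>Polynomials over \<open>CC\<close> are lists with the leading coefficient first, whereas
  \<open>Poly\<close> expects the constant term first; hence the reversal.\<close>

lemma eval_CC: "ring.eval CC p x = poly (Poly (rev p)) x"
proof (induction p)
  case Nil
  show ?case by (simp add: ring.eval.simps[OF ring_CC] CC_simps)
next
  case (Cons a p)
  then show ?case
    by (simp add: ring.eval.simps[OF ring_CC] CC_simps nat_pow_CC Poly_snoc poly_monom)
qed

text \<open>Identifies the two notions of algebraic number, so that the general theorem on elements
  algebraic over a subfield shows \<open>Qbar\<close> to be a field.\<close>

lemma algebraic_CC_iff: "(ring.algebraic CC over \<rat>) x \<longleftrightarrow> algebraic x"
proof
  interpret CC: field CC by (rule field_CC)
  assume "(ring.algebraic CC over \<rat>) x"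
  then obtain p where p: "p \<in> carrier (univ_poly CC \<rat>)" "p \<noteq> []" "ring.eval CC p x = 0"
    using CC.algebraicE[OF subfieldE(1)[OF subfield_Rats_CC]] by (auto simp: CC_simps)
  then have set: "set p \<subseteq> \<rat>" and hd: "hd p \<noteq> 0"
    by (auto simp: univ_poly_def polynomial_def CC_simps)
  show "algebraic x"
  proof (rule algebraicI')
    show "poly (Poly (rev p)) x = 0" using p(3) by (simp add: eval_CC)
    show "poly.coeff (Poly (rev p)) i \<in> \<rat>" for i
      using set by (auto simp: nth_default_def rev_nth subset_iff)
    have "poly.coeff (Poly (rev p)) (length p - 1) = hd p"
      using p(2) by (simp add: nth_default_def rev_nth hd_conv_nth)
    then show "Poly (rev p) \<noteq> 0" using hd by (metis coeff_0)
  qed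
next
  interpret CC: field CC by (rule field_CC)
  assume "algebraic x"
  then obtain p where p: "\<And>i. poly.coeff p i \<in> \<rat>" "p \<noteq> 0" "poly p x = 0"
    unfolding algebraic_altdef by blast
  show "(ring.algebraic CC over \<rat>) x"
  proof (rule CC.algebraicI)
    show "rev (coeffs p) \<noteq> []" using p(2) by simp
    show "ring.eval CC (rev (coeffs p)) x = \<zero>\<^bsub>CC\<^esub>" using p(3) by (simp add: eval_CC CC_simps)
    have "set (coeffs p) \<subseteq> \<rat>" using p(1) by (auto simp: coeffs_def)
    moreover have "last (coeffs p) \<noteq> 0" using p(2) by (simp add: last_coeffs_eq_coeff_degree)
    ultimately show "rev (coeffs p) \<in> carrier (univ_poly CC \<rat>)"
      using p(2) by (simp add: univ_poly_def polynomial_def CC_simps hd_rev)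
  qed
qed

lemma subfield_Qbar: "subfield Qbar CC"
proof -
  have "Qbar = {x \<in> carrier CC. (ring.algebraic CC over \<rat>) x}"
    by (auto simp: Qbar_def algebraic_CC_iff CC_simps)
  then show ?thesis using field.subfield_of_algebraics[OF field_CC subfield_Rats_CC] by simp
qed

lemma subfield_CC_div: "subfield K CC \<Longrightarrow> x \<in> K \<Longrightarrow> y \<in> K \<Longrightarrow> y \<noteq> 0 \<Longrightarrow> x / y \<in> K"
  by (auto simp: subfield_CC_iff divide_inverse)

lemma subfield_CC_power: "subfield K CC \<Longrightarrow> x \<in> K \<Longrightarrow> x ^ n \<in> K"
  by (induction n) (auto simp: subfield_CC_iff)

section \<open>Bases of quadratic extensions\<close>

text \<open>\<open>dimension\<close> is inductive: each step adjoins a vector outside the span built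
  so far. Two steps starting from the zero space adjoin \<open>w\<close>, then \<open>v\<close>, and
  the condition on \<open>v\<close> places it off the line through \<open>w\<close>.\<close>

lemma dimension_2_Rats_iff:
  "ring.dimension CC 2 \<rat> K \<longleftrightarrow>
    (\<exists>v w. w \<noteq> 0 \<and> (\<forall>b\<in>\<rat>. v \<noteq> b * w) \<and> K = {a * v + b * w |a b. a \<in> \<rat> \<and> b \<in> \<rat>})" (is "?l \<longleftrightarrow> ?r")
proof
  interpret CC: field CC by (rule field_CC)
  note line = CC.line_extension_mem_iff[unfolded CC_simps]
  assume ?l
  then have "CC.dimension (Suc (Suc 0)) \<rat> K" by (simp only: numeral_2_eq_2)
  from CC.dimension_backwards[OF subfield_Rats_CC this] obtain v E
    where v: "v \<notin> E" "K = CC.line_extension \<rat> v E" "CC.dimension (Suc 0) \<rat> E"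
    by (elim bexE exE conjE)
  from CC.dimension_backwards[OF subfield_Rats_CC v(3)] obtain w F
    where F: "w \<notin> F" "E = CC.line_extension \<rat> w F" "CC.dimension 0 \<rat> F"
    by (elim bexE exE conjE)
  have "F = {0}" using CC.dimension_zero[OF subfield_Rats_CC F(3)] by (simp only: CC_simps)
  then have w: "w \<noteq> 0" "E = CC.line_extension \<rat> w {0}" using F(1,2) by simp_all
  have E: "E = {b * w |b. b \<in> \<rat>}" unfolding w(2) by (auto simp: line)
  have "K = {a * v + b * w |a b. a \<in> \<rat> \<and> b \<in> \<rat>}"
    unfolding v(2) E set_eq_iff line mem_Collect_eq by blast
  with v(1) w(1) show ?r unfolding E by blast
next
  interpret CC: field CC by (rule field_CC)
  note line = CC.line_extension_mem_iff[unfolded CC_simps]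
  assume ?r
  then obtain v w where vw: "w \<noteq> 0" "\<forall>b\<in>\<rat>. v \<noteq> b * w"
    and K: "K = {a * v + b * w |a b. a \<in> \<rat> \<and> b \<in> \<rat>}" by blast
  define E where "E = CC.line_extension \<rat> w {0}"
  have E: "E = {b * w |b. b \<in> \<rat>}" unfolding E_def by (auto simp: line)
  have "CC.dimension (Suc 0) \<rat> E" unfolding E_def
    by (rule CC.Suc_dim) (use vw CC.zero_dim[of \<rat>] in \<open>auto simp: CC_simps\<close>)
  then have "CC.dimension (Suc (Suc 0)) \<rat> (CC.line_extension \<rat> v E)"
    by (intro CC.Suc_dim) (use vw in \<open>auto simp: CC_simps E\<close>)
  moreover have "CC.line_extension \<rat> v E = K" unfolding K E set_eq_iff line mem_Collect_eq by blast
  ultimately show ?l by (simp only: numeral_2_eq_2)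
qed

text \<open>Cramer's rule passes from the basis \<open>v\<close>, \<open>w\<close> to 1 and
  \<open>t\<close>. If the determinant \<open>D\<close> vanished, \<open>t\<close> would be a
  rational multiple of 1.\<close>

lemma quadratic_extension_basis:
  assumes K: "quadratic_extension K" and t: "t \<in> K" "t \<notin> \<rat>" and u: "u \<in> K"
  obtains \<alpha> \<beta> where "\<alpha> \<in> \<rat>" "\<beta> \<in> \<rat>" "u = \<alpha> + \<beta> * t"
proof -
  obtain v w where vw: "K = {a * v + b * w |a b. a \<in> \<rat> \<and> b \<in> \<rat>}"
    using K unfolding quadratic_extension_def dimension_2_Rats_iff by blast
  have "1 \<in> K" using K by (simp add: quadratic_extension_def subfield_CC_iff)
  then obtain a b where ab: "a \<in> \<rat>" "b \<in> \<rat>" "1 = a * v + b * w" unfolding vw by blast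
  obtain c d where cd: "c \<in> \<rat>" "d \<in> \<rat>" "t = c * v + d * w" using t unfolding vw by blast
  obtain e f where ef: "e \<in> \<rat>" "f \<in> \<rat>" "u = e * v + f * w" using u unfolding vw by blast
  define D where "D = a * d - b * c"
  have Dv: "D * v = d - b * t" and Dw: "D * w = a * t - c"
  proof -
    have "d * 1 - b * t = D * v" unfolding ab(3) cd(3) D_def by (simp add: algebra_simps)
    then show "D * v = d - b * t" by simp
    have "a * t - c * 1 = D * w" unfolding ab(3) cd(3) D_def by (simp add: algebra_simps)
    then show "D * w = a * t - c" by simp
  qed
  have "D \<noteq> 0"
  proof
    assume D: "D = 0"
    show False
    proof (cases "a = 0")
      case True
      then have "b \<noteq> 0" using ab(3) by auto
      then have "t = d / b" using Dv D by (simp add: field_simps)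
      then show False using t(2) cd ab by simp
    next
      case False
      then have "t = c / a" using Dw D by (simp add: field_simps)
      then show False using t(2) cd ab by simp
    qed
  qed
  then have "u = (e * (D * v) + f * (D * w)) / D" using ef(3) by (simp add: field_simps)
  also have "\<dots> = (e * d - f * c) / D + ((f * a - e * b) / D) * t"
    unfolding Dv Dw using \<open>D \<noteq> 0\<close> by (simp add: field_simps)
  finally have "u = (e * d - f * c) / D + ((f * a - e * b) / D) * t" .
  moreover have "D \<in> \<rat>" using ab cd by (simp add: D_def)
  ultimately have "\<exists>\<alpha>\<in>\<rat>. \<exists>\<beta>\<in>\<rat>. u = \<alpha> + \<beta> * t" 
    using ab cd ef by (blast intro: Rats_add Rats_mult Rats_diff Rats_divide)
  then show thesis using that by blast
qed

section \<open>Quadratic points\<close>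

lemma quadratic_point_dichotomy:
  assumes K: "quadratic_extension K" and t: "t \<in> K" and u: "u \<in> K" and eq: "u\<^sup>2 + t ^ 4 + 1 = 0"
  shows "t \<in> \<rat> \<or> (t + 1 / t \<in> \<rat> \<and> u / t \<in> \<rat>)"
proof (cases "t \<in> \<rat>")
  case False
  have "t\<^sup>2 \<in> K" using K t by (simp add: quadratic_extension_def subfield_CC_power)
  from quadratic_extension_basis[OF K t False this] obtain n' s'
    where ns': "n' \<in> \<rat>" "s' \<in> \<rat>" "t\<^sup>2 = n' + s' * t" .
  from quadratic_extension_basis[OF K t False u] obtain \<alpha>' \<beta>'
    where ab': "\<alpha>' \<in> \<rat>" "\<beta>' \<in> \<rat>" "u = \<alpha>' + \<beta>' * t" .
  \<comment> \<open>The sign makes \<open>n\<close> the norm and \<open>s\<close> the trace of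
    \<open>t\<close>.\<close>
  obtain n s \<alpha> \<beta> where rat: "- n' = of_rat n" "s' = of_rat s" "\<alpha>' = of_rat \<alpha>" "\<beta>' = of_rat \<beta>"
    using ns'(1,2) ab'(1,2) by (metis Rats_cases Rats_minus_iff)
  define N S A B :: complex where "N = of_rat n" and "S = of_rat s" and "A = of_rat \<alpha>" and "B = of_rat \<beta>"
  have t2: "t\<^sup>2 = S * t - N" using ns'(3) rat by (simp add: N_def S_def minus_equation_iff[of n'])
  have u': "u = A + B * t" using ab'(3) rat by (simp add: A_def B_def)
  \<comment> \<open>\<open>L\<close> and \<open>C\<close> are the coefficients of \<open>t\<close>
    and 1 in the reduced form of \<open>u^2 + t^4 + 1\<close>; both vanish because \<open>t\<close>
    is irrational.\<close>
  define L where "L = 2 * \<alpha> * \<beta> + \<beta>\<^sup>2 * s + s ^ 3 - 2 * s * n"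
  define C where "C = \<alpha>\<^sup>2 - \<beta>\<^sup>2 * n + 1 + n\<^sup>2 - s\<^sup>2 * n"
  have L: "of_rat L = 2 * A * B + B\<^sup>2 * S + S ^ 3 - 2 * S * N"
    and C: "of_rat C = A\<^sup>2 - B\<^sup>2 * N + 1 + N\<^sup>2 - S\<^sup>2 * N"
    by (simp_all add: L_def C_def N_def S_def A_def B_def of_rat_add of_rat_diff of_rat_mult of_rat_power)
  have "t ^ 4 = (t\<^sup>2)\<^sup>2" by (simp flip: power_mult)
  also have "\<dots> = (S * t - N)\<^sup>2" by (simp only: t2)
  also have "\<dots> = S\<^sup>2 * t\<^sup>2 - 2 * S * N * t + N\<^sup>2" by (simp add: power2_eq_square algebra_simps)
  finally have "u\<^sup>2 + t ^ 4 + 1 = A\<^sup>2 + 2 * A * B * t + (B\<^sup>2 + S\<^sup>2) * t\<^sup>2 - 2 * S * N * t + N\<^sup>2 + 1"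
    unfolding u' by (simp add: power2_eq_square algebra_simps)
  also have "\<dots> = of_rat L * t + of_rat C" unfolding t2 L C
    by (simp add: power2_eq_square power3_eq_cube algebra_simps)
  finally have LC: "of_rat L * t + of_rat C = 0" using eq by simp
  have "L = 0"
  proof (rule ccontr)
    assume "L \<noteq> 0"
    then have "t = - of_rat C / of_rat L" using LC by (simp add: field_simps add_eq_0_iff)
    then show False using False by simp
  qed
  moreover from this have "C = 0" using LC by simp
  ultimately have "n = 1 \<and> \<alpha> = 0" unfolding L_def C_def by (rule quadratic_point_coefficients)
  then have "t\<^sup>2 = S * t - 1" "u = B * t" using t2 u' by (simp_all add: N_def A_def)
  moreover have "t \<noteq> 0" using False by auto
  ultimately have "t + 1 / t = S" "u / t = B" by (simp_all add: field_simps power2_eq_square)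
  then show ?thesis by (simp add: S_def B_def)
qed simp

lemma two_not_Rats_square: "(s :: complex) \<in> \<rat> \<Longrightarrow> s\<^sup>2 \<noteq> 2"
proof
  assume "s \<in> \<rat>" "s\<^sup>2 = 2"
  then obtain q where "s = of_rat q" by (auto elim: Rats_cases)
  with \<open>s\<^sup>2 = 2\<close> have "of_rat (q\<^sup>2) = (of_rat 2 :: complex)" by (simp add: of_rat_power)
  then show False using two_not_rat_square of_rat_eq_iff by blast
qed

lemma sum_even_powers_nonzero:
  fixes x y :: complex
  assumes "x \<in> \<rat>" "y \<in> \<rat>"
  shows "y\<^sup>2 + x ^ 4 + 1 \<noteq> 0"
proof -
  obtain q r where qr: "x = of_rat q" "y = of_rat r" using assms by (auto elim!: Rats_cases)
  have "0 \<le> r\<^sup>2" "0 \<le> q ^ 4" by simp_all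
  then have "r\<^sup>2 + q ^ 4 + 1 \<noteq> 0" by linarith
  then have "of_rat (r\<^sup>2 + q ^ 4 + 1) \<noteq> (0 :: complex)" by simp
  then show ?thesis by (simp add: qr of_rat_add of_rat_power)
qed

text \<open>The case \<open>u = 0\<close> of the dichotomy: \<open>t^4 = -1\<close> gives
  \<open>(t + 1 / t)^2 = 2\<close>, so \<open>t + 1 / t\<close> is irrational. This excludes points
  of the quartic with a zero coordinate.\<close>

lemma no_primitive_8th_root:
  assumes K: "quadratic_extension K" and t: "t \<in> K"
  shows "t ^ 4 + 1 \<noteq> 0"
proof
  assume eq: "t ^ 4 + 1 = 0"
  have "0 \<in> K" using K subringE(2)[OF subfieldE(1), of K CC] by (simp add: quadratic_extension_def CC_simps)
  then have "t \<in> \<rat> \<or> t + 1 / t \<in> \<rat>" using quadratic_point_dichotomy[OF K t, of 0] eq by simp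
  moreover have "t \<notin> \<rat>" using sum_even_powers_nonzero[of t 0] eq by auto
  moreover have "(t + 1 / t)\<^sup>2 = 2"
  proof -
    have "t \<noteq> 0" using eq by auto
    then have "t * (t + 1 / t) = t\<^sup>2 + 1" by (simp add: distrib_left power2_eq_square)
    then have "t\<^sup>2 * (t + 1 / t)\<^sup>2 = (t\<^sup>2 + 1)\<^sup>2" by (simp only: flip: power_mult_distrib)
    also have "\<dots> = (t ^ 4 + 1) + t\<^sup>2 * 2" by (simp add: power2_eq_square algebra_simps eval_nat_numeral)
    finally show ?thesis using eq \<open>t \<noteq> 0\<close> by simp
  qed
  ultimately show False using two_not_Rats_square by blast
qed

section \<open>Roots of unity and the affine quadratic points\<close>

lemma zeta3_square: "zeta3\<^sup>2 = - zeta3 - 1"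
proof -
  have zeta3: "zeta3 = cis (2 * pi / 3)" by (simp add: zeta3_def cis_conv_exp mult.commute)
  have re: "Re zeta3 = - 1 / 2" and im: "Im zeta3 = sqrt 3 / 2"
    unfolding zeta3 by (simp_all only: cis.sel cos_120 sin_120)
  show ?thesis by (intro complex_eqI) (simp_all add: power2_eq_square re im)
qed

lemma zeta3_not_Rats: "zeta3 \<notin> \<rat>"
proof
  assume "zeta3 \<in> \<rat>"
  then obtain q where q: "zeta3 = of_rat q" by (auto elim: Rats_cases)
  have "of_rat (q\<^sup>2 + q + 1) = (0 :: complex)" using zeta3_square by (simp add: q of_rat_add of_rat_power)
  then have q0: "q\<^sup>2 + q + 1 = 0" by (simp only: of_rat_eq_0_iff)
  have "(2 * q + 1)\<^sup>2 = 4 * (q\<^sup>2 + q + 1) - 3" by (simp add: power2_eq_square algebra_simps)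
  then have "(2 * q + 1)\<^sup>2 = - 3" unfolding q0 by (simp only: mult_zero_right diff_0)
  then have "(2 * q + 1)\<^sup>2 < 0" by (simp only: neg_less_0_iff_less zero_less_numeral)
  then show False by (simp only: power2_less_0)
qed

text \<open>These are the affine coordinates \<open>(y, z)\<close> of the eight points
  \<open>[1 : y : z]\<close>.\<close>

definition zeta_pairs :: "(complex \<times> complex) set" where
  "zeta_pairs = {zeta3, - zeta3} \<times> {zeta3\<^sup>2, - zeta3\<^sup>2} \<union> {zeta3\<^sup>2, - zeta3\<^sup>2} \<times> {zeta3, - zeta3}"

text \<open>With \<open>s = x + 1 / x\<close>, reduction gives \<open>x^3 = (s^2 - 1) x - s\<close>.
  Since \<open>x^3\<close> is rational and \<open>x\<close> is not, \<open>s\<close> is 1 or -1, and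
  \<open>x\<close> is a primitive sixth or third root of unity respectively.\<close>

lemma quadratic_root_zeta3:
  assumes "x \<notin> \<rat>" "x + 1 / x \<in> \<rat>" "x ^ 3 \<in> \<rat>"
  shows "x \<in> {zeta3, - zeta3, zeta3\<^sup>2, - zeta3\<^sup>2}"
proof -
  define s where "s = x + 1 / x"
  have x0: "x \<noteq> 0" using assms(1) by auto
  then have x2: "x\<^sup>2 = s * x - 1" by (simp add: s_def distrib_right power2_eq_square)
  have "x ^ 3 = x * x\<^sup>2" by (simp add: power3_eq_cube power2_eq_square)
  also have "\<dots> = x * (s * x - 1)" by (simp only: x2)
  also have "\<dots> = s * x\<^sup>2 - x" by (simp add: power2_eq_square algebra_simps)
  finally have "x ^ 3 = s * x\<^sup>2 - x" .
  then have x3: "x ^ 3 = (s\<^sup>2 - 1) * x - s" unfolding x2 by (simp add: power2_eq_square algebra_simps)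
  have "s\<^sup>2 - 1 = 0"
  proof (rule ccontr)
    assume "s\<^sup>2 - 1 \<noteq> 0"
    then have "x = (x ^ 3 + s) / (s\<^sup>2 - 1)" using x3 by (simp add: field_simps)
    moreover have "(x ^ 3 + s) / (s\<^sup>2 - 1) \<in> \<rat>" using assms(2,3) by (simp add: s_def[symmetric])
    ultimately show False using assms(1) by simp
  qed
  then consider "s = 1" | "s = - 1" by (auto simp: power2_eq_1_iff)
  then show ?thesis
  proof cases
    case 1
    have "(x + zeta3) * (x + zeta3\<^sup>2) = x\<^sup>2 - x - (zeta3\<^sup>2 + zeta3)"
      unfolding zeta3_square by (simp add: algebra_simps flip: power2_eq_square) (simp add: zeta3_square)
    also have "\<dots> = 0" unfolding x2 1 zeta3_square by simp
    finally have "(x + zeta3) * (x + zeta3\<^sup>2) = 0" .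
    then show ?thesis by (auto simp: add_eq_0_iff2)
  next
    case 2
    have "(x - zeta3) * (x - zeta3\<^sup>2) = x\<^sup>2 + x - (zeta3\<^sup>2 + zeta3)"
      unfolding zeta3_square by (simp add: algebra_simps flip: power2_eq_square) (simp add: zeta3_square)
    also have "\<dots> = 0" unfolding x2 2 zeta3_square by simp
    finally have "(x - zeta3) * (x - zeta3\<^sup>2) = 0" .
    then show ?thesis by auto
  qed
qed

lemma affine_quadratic_points:
  assumes K: "quadratic_extension K" and x: "x \<in> K" and y: "y \<in> K" and eq: "1 + x ^ 4 + y ^ 4 = 0"
  shows "(x, y) \<in> zeta_pairs"
proof -
  have sub: "subfield K CC" using K by (simp add: quadratic_extension_def)
  have x0: "x \<noteq> 0" using no_primitive_8th_root[OF K y] eq by (auto simp: add.commute)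
  have y0: "y \<noteq> 0" using no_primitive_8th_root[OF K x] eq by (auto simp: add.commute)
  have one: "1 \<in> K" using sub by (simp add: subfield_CC_iff)
  have A: "x \<in> \<rat> \<or> (x + 1 / x \<in> \<rat> \<and> y\<^sup>2 / x \<in> \<rat>)"
    using quadratic_point_dichotomy[OF K x, of "y\<^sup>2"] eq subfield_CC_power[OF sub y]
    by (simp add: ac_simps flip: power_mult)
  have B: "y \<in> \<rat> \<or> (y + 1 / y \<in> \<rat> \<and> x\<^sup>2 / y \<in> \<rat>)"
    using quadratic_point_dichotomy[OF K y, of "x\<^sup>2"] eq subfield_CC_power[OF sub x]
    by (simp add: ac_simps flip: power_mult)
  have C: "y / x \<in> \<rat> \<or> (1 / x\<^sup>2) / (y / x) \<in> \<rat>"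
  proof -
    \<comment> \<open>Division by \<open>x^4\<close> permutes the three coordinates, so the term
      that was 1 now supplies the square.\<close>
    have "(1 / x\<^sup>2)\<^sup>2 + (y / x) ^ 4 + 1 = (1 + x ^ 4 + y ^ 4) / x ^ 4"
      using x0 by (simp add: field_simps flip: power_mult)
    then have "(1 / x\<^sup>2)\<^sup>2 + (y / x) ^ 4 + 1 = 0" using eq by simp
    moreover have "1 / x\<^sup>2 \<in> K" "y / x \<in> K"
      using subfield_CC_div[OF sub] subfield_CC_power[OF sub x] one x y x0 by simp_all
    ultimately show ?thesis using quadratic_point_dichotomy[OF K] by blast
  qed
  \<comment> \<open>If only one coordinate \<open>a\<close> were rational, the dichotomy for the
    other coordinate \<open>b\<close> would make \<open>a^2 / b\<close>, and so \<open>b\<close>,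
    rational.\<close>
  have rat_y: "x \<in> \<rat> \<longleftrightarrow> y \<in> \<rat>"
  proof -
    have False if "a \<in> \<rat>" "b \<notin> \<rat>" "b \<noteq> 0" "a \<noteq> 0" "a\<^sup>2 / b \<in> \<rat>" for a b :: complex
    proof -
      have "b = a\<^sup>2 / (a\<^sup>2 / b)" using that by simp
      also have "\<dots> \<in> \<rat>" using Rats_divide[OF Rats_power[OF that(1)] that(5)] .
      finally show False using that by simp
    qed
    then show ?thesis using A B x0 y0 by metis
  qed
  have nx: "x \<notin> \<rat>"
  proof
    assume "x \<in> \<rat>"
    then have "y \<in> \<rat>" using rat_y by simp
    then show False using sum_even_powers_nonzero[of x "y\<^sup>2"] \<open>x \<in> \<rat>\<close> eq
      by (simp add: ac_simps flip: power_mult)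
  qed
  then have ny: "y \<notin> \<rat>" using rat_y by simp
  from A B nx ny have xr: "x + 1 / x \<in> \<rat>" "y\<^sup>2 / x \<in> \<rat>" and yr: "y + 1 / y \<in> \<rat>" "x\<^sup>2 / y \<in> \<rat>" by simp_all
  have "y / x \<notin> \<rat>"
  proof
    assume r: "y / x \<in> \<rat>"
    have "y = (y\<^sup>2 / x) / (y / x)" using x0 y0 by (simp add: field_simps power2_eq_square)
    also have "\<dots> \<in> \<rat>" using xr(2) r by (rule Rats_divide)
    finally show False using ny by simp
  qed
  then have "(1 / x\<^sup>2) / (y / x) \<in> \<rat>" using C by blast
  then have xy: "1 / (x * y) \<in> \<rat>" using x0 by (simp add: field_simps power2_eq_square)
  have "x ^ 3 = (x\<^sup>2 / y) / (1 / (x * y))" using x0 y0 by (simp add: field_simps eval_nat_numeral)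
  also have "\<dots> \<in> \<rat>" using yr(2) xy by (rule Rats_divide)
  finally have x3: "x ^ 3 \<in> \<rat>" .
  have "y ^ 3 = (y\<^sup>2 / x) / (1 / (x * y))" using x0 y0 by (simp add: field_simps eval_nat_numeral)
  also have "\<dots> \<in> \<rat>" using xr(2) xy by (rule Rats_divide)
  finally have y3: "y ^ 3 \<in> \<rat>" .
  have x': "x \<in> {zeta3, - zeta3, zeta3\<^sup>2, - zeta3\<^sup>2}" and y': "y \<in> {zeta3, - zeta3, zeta3\<^sup>2, - zeta3\<^sup>2}"
    using quadratic_root_zeta3 nx ny xr yr x3 y3 by blast+
  \<comment> \<open>This rules out \<open>x\<close> and \<open>y\<close> both coming from
    \<open>zeta3\<close> or both from its square, up to sign.\<close>
  have "x \<noteq> y" "x \<noteq> - y" using \<open>y / x \<notin> \<rat>\<close> x0 y0 by auto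
  then show ?thesis using x' y' unfolding zeta_pairs_def by auto
qed

section \<open>Normalised projective representatives\<close>

lemma hpt_scale:
  assumes "c \<in> Qbar" "c \<noteq> 0"
  shows "hpt (c * x) (c * y) (c * z) = hpt x y z"
proof -
  note Q = subfield_Qbar[unfolded subfield_CC_iff]
  have "hpt (c * x) (c * y) (c * z) \<subseteq> hpt x y z"
  proof
    fix p assume "p \<in> hpt (c * x) (c * y) (c * z)"
    then obtain d where "d \<in> Qbar" "d \<noteq> 0" "p = ((d * c) * x, (d * c) * y, (d * c) * z)"
      by (auto simp: hpt_def ac_simps)
    moreover from this have "d * c \<in> Qbar" "d * c \<noteq> 0" using Q assms by auto
    ultimately show "p \<in> hpt x y z" unfolding hpt_def by blast
  qed
  moreover have "hpt x y z \<subseteq> hpt (c * x) (c * y) (c * z)"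
  proof
    fix p assume "p \<in> hpt x y z"
    then obtain d where d: "d \<in> Qbar" "d \<noteq> 0" "p = (d * x, d * y, d * z)"
      by (auto simp: hpt_def)
    then have "p = (d / c * (c * x), d / c * (c * y), d / c * (c * z))" using assms by simp
    moreover have "d / c \<in> Qbar" "d / c \<noteq> 0"
      using d assms subfield_CC_div[OF subfield_Qbar] by auto
    ultimately show "p \<in> hpt (c * x) (c * y) (c * z)" unfolding hpt_def by blast
  qed
  ultimately show ?thesis by blast
qed

lemma hpt_self_mem: "(x, y, z) \<in> hpt x y z"
proof -
  have "1 \<in> Qbar" using subfield_Qbar by (simp add: subfield_CC_iff)
  then show ?thesis unfolding hpt_def by force
qed

lemma hpt_1_eq_iff: "hpt 1 y z = hpt 1 y' z' \<longleftrightarrow> y = y' \<and> z = z'"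
proof
  assume "hpt 1 y z = hpt 1 y' z'"
  then have "(1, y, z) \<in> hpt 1 y' z'" using hpt_self_mem by blast
  then show "y = y' \<and> z = z'" by (auto simp: hpt_def)
qed simp

section \<open>The quadratic field generated by \<open>zeta3\<close>\<close>

text \<open>The factor 1 is kept to match the two-vector form in
  \<open>dimension_2_Rats_iff\<close>, with basis \<open>zeta3\<close>, 1.\<close>

definition Q_zeta3 :: "complex set" where
  "Q_zeta3 = {a * zeta3 + b * 1 |a b. a \<in> \<rat> \<and> b \<in> \<rat>}"

lemma Q_zeta3I: "a \<in> \<rat> \<Longrightarrow> b \<in> \<rat> \<Longrightarrow> x = a * zeta3 + b \<Longrightarrow> x \<in> Q_zeta3"
  unfolding Q_zeta3_def by auto

lemma subfield_Q_zeta3: "subfield Q_zeta3 CC"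
  unfolding subfield_CC_iff
proof (intro conjI ballI impI)
  show "1 \<in> Q_zeta3" by (rule Q_zeta3I[of 0 1]) simp_all
next
  fix x assume "x \<in> Q_zeta3"
  then obtain a b where x: "a \<in> \<rat>" "b \<in> \<rat>" "x = a * zeta3 + b" by (auto simp: Q_zeta3_def)
  then show "- x \<in> Q_zeta3" by (intro Q_zeta3I[of "- a" "- b"]) simp_all
  assume x0: "x \<noteq> 0"
  \<comment> \<open>\<open>x'\<close> is the conjugate of \<open>x\<close>, obtained by replacing
    \<open>zeta3\<close> with \<open>zeta3^2 = - zeta3 - 1\<close>, and \<open>N\<close> is the norm
    of \<open>x\<close>.\<close>
  define N where "N = a\<^sup>2 - a * b + b\<^sup>2"
  define x' where "x' = - a * zeta3 + (b - a)"
  have "x * x' = - a\<^sup>2 * zeta3\<^sup>2 - a\<^sup>2 * zeta3 + b\<^sup>2 - a * b"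
    unfolding x(3) x'_def by (simp add: algebra_simps power2_eq_square)
  then have xx': "x * x' = N" unfolding zeta3_square N_def by (simp add: algebra_simps)
  have "x' \<noteq> 0"
  proof
    assume "x' = 0"
    then have eq: "a * zeta3 = b - a" by (simp add: x'_def)
    have "a = 0"
    proof (rule ccontr)
      assume "a \<noteq> 0"
      then have "zeta3 = (b - a) / a" using eq by (simp add: field_simps)
      moreover have "(b - a) / a \<in> \<rat>" using x(1,2) by simp
      ultimately show False using zeta3_not_Rats by metis
    qed
    then show False using eq x0 x(3) by simp
  qed
  then have "N \<noteq> 0" using xx' x0 by auto
  then have "inverse x = x' / N" using xx' x0 by (simp add: field_simps)
  also have "\<dots> = (- a / N) * zeta3 + (b - a) / N" by (simp add: x'_def add_divide_distrib diff_divide_distrib)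
  finally show "inverse x \<in> Q_zeta3"
    by (intro Q_zeta3I[of "- a / N" "(b - a) / N"]) (use x in \<open>simp_all add: N_def\<close>)
next
  fix x y assume "x \<in> Q_zeta3" "y \<in> Q_zeta3"
  then obtain a b c d where x: "a \<in> \<rat>" "b \<in> \<rat>" "x = a * zeta3 + b"
    and y: "c \<in> \<rat>" "d \<in> \<rat>" "y = c * zeta3 + d" by (auto simp: Q_zeta3_def)
  then show "x + y \<in> Q_zeta3" by (intro Q_zeta3I[of "a + c" "b + d"]) (simp_all add: algebra_simps)
  have "x * y = a * c * zeta3\<^sup>2 + (a * d + b * c) * zeta3 + b * d"
    unfolding x(3) y(3) by (simp add: algebra_simps power2_eq_square)
  then have "x * y = (a * d + b * c - a * c) * zeta3 + (b * d - a * c)"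
    unfolding zeta3_square by (simp add: algebra_simps)
  then show "x * y \<in> Q_zeta3"
    by (intro Q_zeta3I[of "a * d + b * c - a * c" "b * d - a * c"]) (use x y in simp_all)
qed

lemma zeta3_in_Qbar: "zeta3 \<in> Qbar"
proof -
  have "poly [:1, 1, 1:] zeta3 = 0" using zeta3_square by (simp add: algebra_simps power2_eq_square)
  moreover have "poly.coeff [:1, 1, 1 :: complex:] i \<in> \<rat>" for i
    by (simp add: coeff_pCons split: nat.split)
  ultimately show ?thesis unfolding Qbar_def by (auto intro: algebraicI'[of "[:1, 1, 1:]"])
qed

lemma quadratic_extension_Q_zeta3: "quadratic_extension Q_zeta3"
proof -
  have "Q_zeta3 \<subseteq> Qbar"
  proof
    fix x assume "x \<in> Q_zeta3"
    then obtain a b where "a \<in> \<rat>" "b \<in> \<rat>" and x: "x = a * zeta3 + b" by (auto simp: Q_zeta3_def)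
    then have "a \<in> Qbar" "b \<in> Qbar" by (auto simp: Qbar_def rat_imp_algebraic)
    then show "x \<in> Qbar" unfolding x using subfield_Qbar zeta3_in_Qbar by (simp add: subfield_CC_iff)
  qed
  moreover have "ring.dimension CC 2 \<rat> Q_zeta3"
    unfolding dimension_2_Rats_iff Q_zeta3_def
    by (intro exI[of _ zeta3] exI[of _ 1]) (use zeta3_not_Rats in auto)
  ultimately show ?thesis using subfield_Q_zeta3 by (simp add: quadratic_extension_def)
qed

section \<open>The eight points and their count\<close>

lemma hpt_1_mem_C4:
  assumes "1 \<in> K" "y \<in> K" "z \<in> K" "1 + y ^ 4 + z ^ 4 = 0"
  shows "hpt 1 y z \<in> C4 K"
proof -
  have "hpt 1 y z \<in> P2 K"
    unfolding P2_def mem_Collect_eq by (intro exI conjI, rule refl) (use assms(1-3) in simp_all)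
  have "u ^ 4 + v ^ 4 + w ^ 4 = 0" if uvw: "(u, v, w) \<in> hpt 1 y z" for u v w
  proof -
    obtain c where "u = c * 1" "v = c * y" "w = c * z" using uvw unfolding hpt_def by blast
    then have "u ^ 4 + v ^ 4 + w ^ 4 = c ^ 4 * (1 + y ^ 4 + z ^ 4)"
      by (simp add: power_mult_distrib algebra_simps)
    then show ?thesis using assms(4) by simp
  qed
  then have "\<forall>(u, v, w) \<in> hpt 1 y z. u ^ 4 + v ^ 4 + w ^ 4 = 0" by clarsimp
  with \<open>hpt 1 y z \<in> P2 K\<close> show ?thesis unfolding C4_def mem_Collect_eq by (rule conjI)
qed

text \<open>Fourth powers remove the signs and fix cube roots of unity, so the sum becomes
  \<open>1 + zeta3 + zeta3^2 = 0\<close>.\<close>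

lemma zeta_pairs_sum: "(y, z) \<in> zeta_pairs \<Longrightarrow> 1 + y ^ 4 + z ^ 4 = 0"
proof -
  have 3: "zeta3 ^ 3 = 1"
  proof -
    have "zeta3 ^ 3 = zeta3 * zeta3\<^sup>2" by (simp add: power3_eq_cube power2_eq_square)
    also have "\<dots> = zeta3 * (- zeta3 - 1)" by (simp only: zeta3_square)
    also have "\<dots> = - zeta3\<^sup>2 - zeta3" by (simp add: algebra_simps power2_eq_square)
    finally show ?thesis by (simp add: zeta3_square)
  qed
  have "zeta3 ^ 4 = zeta3 ^ 3 * zeta3" by (simp add: eval_nat_numeral)
  then have 4: "zeta3 ^ 4 = zeta3" unfolding 3 by simp
  have "(zeta3\<^sup>2) ^ 4 = (zeta3 ^ 4)\<^sup>2" by (simp flip: power_mult)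
  then have 8: "(zeta3\<^sup>2) ^ 4 = zeta3\<^sup>2" unfolding 4 .
  assume "(y, z) \<in> zeta_pairs"
  then have "y ^ 4 = zeta3 \<and> z ^ 4 = zeta3\<^sup>2 \<or> y ^ 4 = zeta3\<^sup>2 \<and> z ^ 4 = zeta3"
    unfolding zeta_pairs_def using 4 8 by auto
  then show ?thesis by (auto simp: zeta3_square)
qed

lemma card_zeta_pairs: "card zeta_pairs = 8"
proof -
  have z0: "zeta3 \<noteq> 0" using zeta3_not_Rats by auto
  \<comment> \<open>Equality in either case would force \<open>zeta3\<close> to be 1 or -1, hence
    rational. The two sign classes are therefore disjoint.\<close>
  have "zeta3\<^sup>2 \<noteq> zeta3" "zeta3\<^sup>2 \<noteq> - zeta3"
  proof -
    have "zeta3 \<noteq> 1" "zeta3 \<noteq> - 1" using zeta3_not_Rats by (metis Rats_1, metis Rats_1 Rats_minus_iff)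
    then have "zeta3 * (zeta3 - 1) \<noteq> 0" "zeta3 * (zeta3 + 1) \<noteq> 0" using z0 by (simp_all add: add_eq_0_iff2)
    then show "zeta3\<^sup>2 \<noteq> zeta3" "zeta3\<^sup>2 \<noteq> - zeta3"
      by (simp_all add: right_diff_distrib distrib_left power2_eq_square add_eq_0_iff2)
  qed
  then have disj: "{zeta3, - zeta3} \<inter> {zeta3\<^sup>2, - zeta3\<^sup>2} = {}"
    by (auto simp: minus_equation_iff)
  have c: "card {zeta3, - zeta3} = 2" "card {zeta3\<^sup>2, - zeta3\<^sup>2} = 2" using z0 by simp_all
  have "card zeta_pairs = card ({zeta3, - zeta3} \<times> {zeta3\<^sup>2, - zeta3\<^sup>2})
      + card ({zeta3\<^sup>2, - zeta3\<^sup>2} \<times> {zeta3, - zeta3})"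
    unfolding zeta_pairs_def by (rule card_Un_disjoint) (simp, simp, use disj in blast)
  then show ?thesis unfolding card_cartesian_product c by simp
qed

lemma quadratic_points_C4:
  "{P \<in> C4 Qbar. defined_over_quadratic P} = (\<lambda>(y, z). hpt 1 y z) ` zeta_pairs"
proof (intro equalityI subsetI)
  fix P assume "P \<in> {P \<in> C4 Qbar. defined_over_quadratic P}"
  then obtain K where K: "quadratic_extension K" and "P \<in> C4 K"
    by (auto simp: defined_over_quadratic_def)
  then obtain x y z where P: "P = hpt x y z" and xyz: "x \<in> K" "y \<in> K" "z \<in> K" "(x, y, z) \<noteq> (0, 0, 0)"
    and P0: "\<forall>(x, y, z) \<in> P. x ^ 4 + y ^ 4 + z ^ 4 = 0"
    by (auto simp: C4_def P2_def)
  have eq: "x ^ 4 + y ^ 4 + z ^ 4 = 0" using P0 hpt_self_mem[of x y z] unfolding P by blast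
  have sub: "subfield K CC" and Qbar: "K \<subseteq> Qbar" using K by (simp_all add: quadratic_extension_def)
  \<comment> \<open>If \<open>x = 0\<close>, then \<open>z\<close> is nonzero and
    \<open>y / z\<close> is a primitive eighth root of unity in \<open>K\<close>.\<close>
  have "x \<noteq> 0"
  proof
    assume x0: "x = 0"
    then have "z \<noteq> 0" using eq xyz(4) by auto
    then have "(y / z) ^ 4 + 1 = 0" using eq x0 by (simp add: field_simps)
    then show False using no_primitive_8th_root[OF K] subfield_CC_div[OF sub xyz(2,3) \<open>z \<noteq> 0\<close>] by blast
  qed
  have "1 + (y / x) ^ 4 + (z / x) ^ 4 = (x ^ 4 + y ^ 4 + z ^ 4) / x ^ 4"
    using \<open>x \<noteq> 0\<close> by (simp add: power_divide add_divide_distrib)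
  then have "(y / x, z / x) \<in> zeta_pairs"
    using affine_quadratic_points[OF K] subfield_CC_div[OF sub] xyz \<open>x \<noteq> 0\<close> eq by simp
  moreover have "P = hpt 1 (y / x) (z / x)"
    using hpt_scale[of x 1 "y / x" "z / x"] \<open>x \<noteq> 0\<close> xyz(1) Qbar by (auto simp: P)
  ultimately show "P \<in> (\<lambda>(y, z). hpt 1 y z) ` zeta_pairs" by force
next
  fix P assume "P \<in> (\<lambda>(y, z). hpt 1 y z) ` zeta_pairs"
  then obtain y z where yz: "(y, z) \<in> zeta_pairs" and P: "P = hpt 1 y z" by auto
  \<comment> \<open>A single quadratic field, that of \<open>zeta3\<close>, contains the coordinates
    of all eight points.\<close>
  note K = quadratic_extension_Q_zeta3
  note sub = subfield_Q_zeta3[unfolded subfield_CC_iff]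
  have z: "zeta3 \<in> Q_zeta3" by (rule Q_zeta3I[of 1 0]) simp_all
  then have "y \<in> Q_zeta3" "z \<in> Q_zeta3"
    using yz sub subfield_CC_power[OF subfield_Q_zeta3 z, of 2] by (auto simp: zeta_pairs_def)
  moreover have "Q_zeta3 \<subseteq> Qbar" "1 \<in> Q_zeta3" using K sub by (auto simp: quadratic_extension_def)
  ultimately have "P \<in> C4 Q_zeta3" "P \<in> C4 Qbar"
    unfolding P using hpt_1_mem_C4 zeta_pairs_sum[OF yz] by (meson subsetD)+
  then show "P \<in> {P \<in> C4 Qbar. defined_over_quadratic P}"
    using K by (auto simp: defined_over_quadratic_def)
qed

theorem theorem1p4:
  shows "card {P \<in> C4 Qbar. defined_over_quadratic P} = 8
    \<and> {P \<in> C4 Qbar. defined_over_quadratic P} =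
        {hpt 1 (s * zeta3) (t * zeta3 ^ 2) |s t. s \<in> {1, -1} \<and> t \<in> {1, -1}}
      \<union> {hpt 1 (s * zeta3 ^ 2) (t * zeta3) |s t. s \<in> {1, -1} \<and> t \<in> {1, -1}}"
proof
  have "inj (\<lambda>(y, z). hpt 1 y z)" by (rule injI) (clarsimp simp: hpt_1_eq_iff)
  then have "inj_on (\<lambda>(y, z). hpt 1 y z) zeta_pairs" by (rule inj_on_subset) simp
  then show "card {P \<in> C4 Qbar. defined_over_quadratic P} = 8"
    unfolding quadratic_points_C4 by (simp add: card_image card_zeta_pairs)
  \<comment> \<open>Rewrites a choice of two independent signs as a product of two-element sets, the
    shape of each half of \<open>zeta_pairs\<close>.\<close>
  have signs: "{F (s * a) (t * b) |s t. s \<in> {1, -1} \<and> t \<in> {1, -1}} = (\<lambda>(y, z). F y z) ` ({a, - a} \<times> {b, - b})"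
    for F :: "complex \<Rightarrow> complex \<Rightarrow> proj_pt" and a b
  proof -
    have "{F (s * a) (t * b) |s t. s \<in> {1, -1} \<and> t \<in> {1, -1}}
        = (\<lambda>(s, t). F (s * a) (t * b)) ` ({1, -1} \<times> {1, -1})" by (force simp: image_def)
    also have "\<dots> = (\<lambda>(y, z). F y z) ` ({a, - a} \<times> {b, - b})" by (simp add: insert_Times_insert)
    finally show ?thesis .
  qed
  show "{P \<in> C4 Qbar. defined_over_quadratic P} =
        {hpt 1 (s * zeta3) (t * zeta3 ^ 2) |s t. s \<in> {1, -1} \<and> t \<in> {1, -1}}
      \<union> {hpt 1 (s * zeta3 ^ 2) (t * zeta3) |s t. s \<in> {1, -1} \<and> t \<in> {1, -1}}"
    unfolding quadratic_points_C4 zeta_pairs_def image_Un signs ..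
qed

end
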